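(* The series below converges and $$\sum_{k=1}^{\infty} \frac{(-1)^{k-1}(28k^2 -8k+1) \binom{2k}{k}^2}{(2k-1)^2\, k\, \binom{6k}{3k} \binom{3k}{k}} = 2 \log 2.$$
   Context: $\binom{n}{m}$ denotes the binomial coefficient and $\log$ the natural logarithm. *)

theory Defs
  imports Complex_Main
begin

end

theory Submission
  imports Defs "HOL-Analysis.Harmonic_Numbers"
begin

text \<open>
  The series is a Wilf--Zeilberger acceleration of
  \<open>2 log 2 = \<Sum>k. 1 / ((2k + 1) (k + 1))\<close>. The latter is the row \<open>n = 0\<close> of the kernel
  \<open>V = wz_kernel\<close>, whose mate \<open>G n k = V n k * wz_cert n k\<close> satisfies
  \<open>V (n+1) k - V n k = G n (k+1) - G n k\<close>. Summing over \<open>k\<close>, consecutive row sums of \<open>V\<close> drop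
  by \<open>G n 0\<close>, which is the term of the series with \<open>k = n + 1\<close>, and the row sums tend to \<open>0\<close>
  because \<open>\<bar>V (n+1) k\<bar> \<le> \<bar>V n k\<bar> / 3\<close>.
\<close>

text \<open>At \<open>k = 0\<close> the long Pochhammer symbol is
  \<open>pochhammer (1/2) (3 * n + 1) / pochhammer (1/2) n\<close>, which is what brings in the
  binomial coefficients of the series.\<close>

definition wz_kernel :: "nat \<Rightarrow> nat \<Rightarrow> real" where
  "wz_kernel n k = (-1) ^ n * pochhammer (1/2) n * pochhammer (3/2) n
     / (2 * pochhammer (real k + real n + 1/2) (2 * n + 1) * (real k + 2 * real n + 1))"

text \<open>Found by solving the Wilf--Zeilberger equation for a polynomial of degree 4 in \<open>y\<close>.\<close>

definition wz_num :: "real \<Rightarrow> real \<Rightarrow> real" where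
  "wz_num x y =
     (84 + 612 * x + 1744 * x^2 + 2432 * x^3 + 1664 * x^4 + 448 * x^5)
     + (185 + 1052 * x + 2196 * x^2 + 2000 * x^3 + 672 * x^4) * y
     + (157 + 636 * x + 844 * x^2 + 368 * x^3) * y^2
     + (58 + 144 * x + 88 * x^2) * y^3
     + (8 + 8 * x) * y^4"

text \<open>Real arguments allow the Wilf--Zeilberger equation to be checked as an identity of
  rational functions.\<close>

definition wz_cert :: "real \<Rightarrow> real \<Rightarrow> real" where
  "wz_cert x y = wz_num x y
     / (8 * (x + 1) * (2 * x + 1) * (y + 2 * x + 2) * (y + 3 * x + 3/2) * (y + 3 * x + 5/2))"

section \<open>Shift quotients of the kernel and the Wilf--Zeilberger equation\<close>

lemma pochhammer_shift:
  fixes x :: "'a :: field_char_0"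
  assumes "x \<noteq> 0"
  shows "pochhammer (x + 1) m = pochhammer x m * (x + of_nat m) / x"
  using pochhammer_rec[of x m] pochhammer_Suc[of x m] assms by (simp add: field_simps)

lemma wz_kernel_Suc_right:
  "wz_kernel n (Suc k) = wz_kernel n k *
     ((real k + real n + 1/2) * (real k + 2 * real n + 1)
      / ((real k + 3 * real n + 3/2) * (real k + 2 * real n + 2)))"
proof -
  define x where "x = real k + real n + 1/2"
  have x: "x > 0" by (simp add: x_def)
  define p where "p = pochhammer x (2 * n + 1)"
  have p: "p > 0" unfolding p_def using x by (rule pochhammer_pos)
  have *: "pochhammer (real (Suc k) + real n + 1/2) (2 * n + 1) = p * (real k + 3 * real n + 3/2) / x"
    using pochhammer_shift[of x "2 * n + 1"] x
    by (simp add: x_def p_def algebra_simps)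
  define u y z where uyz: "u = real k + 3 * real n + 3/2" "y = real k + 2 * real n + 1"
    "z = real k + 2 * real n + 2"
  have pos: "u > 0" "y > 0" "z > 0"
    by (simp_all add: uyz)
  have z: "real (Suc k) + 2 * real n + 1 = z" by (simp add: uyz)
  define c where "c = (-1) ^ n * pochhammer (1/2) n * pochhammer (3/2 :: real) n"
  have "wz_kernel n (Suc k) = c / (2 * (p * u / x) * z)"
    unfolding wz_kernel_def * z by (simp add: c_def uyz)
  also have "\<dots> = c / (2 * p * y) * (x * y / (u * z))"
    using pos x p by (simp add: field_simps)
  finally show ?thesis
    by (simp add: wz_kernel_def c_def p_def x_def uyz)
qed

text \<open>The base of the long Pochhammer symbol grows by 1 and its length by 2, so it loses its
  first factor and gains three factors at the end.\<close>

lemma wz_kernel_Suc_left: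
  "wz_kernel (Suc n) k = - wz_kernel n k *
     ((real n + 1/2) * (real n + 3/2) * (real k + real n + 1/2) * (real k + 2 * real n + 1)
      / ((real k + 3 * real n + 3/2) * (real k + 3 * real n + 5/2) * (real k + 3 * real n + 7/2)
         * (real k + 2 * real n + 3)))"
proof -
  define x where "x = real k + real n + 1/2"
  have x: "x > 0" by (simp add: x_def)
  define p where "p = pochhammer x (2 * n + 1)"
  have p: "p > 0" unfolding p_def using x by (rule pochhammer_pos)
  have "pochhammer (x + 1) (2 * n + 3) =
      pochhammer (x + 1) (2 * n + 1) * (x + 2 * n + 2) * (x + 2 * n + 3)"
    by (simp add: numeral_3_eq_3 pochhammer_Suc algebra_simps)
  also have "\<dots> = p * (real k + 3 * real n + 3/2) / x
      * (real k + 3 * real n + 5/2) * (real k + 3 * real n + 7/2)"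
    using pochhammer_shift[of x "2 * n + 1"] x
    by (simp add: x_def p_def algebra_simps)
  also have "pochhammer (x + 1) (2 * n + 3)
      = pochhammer (real k + real (Suc n) + 1/2) (2 * Suc n + 1)"
    by (simp add: x_def algebra_simps numeral_3_eq_3)
  finally have *: "pochhammer (real k + real (Suc n) + 1/2) (2 * Suc n + 1) =
      p * (real k + 3 * real n + 3/2) / x
      * (real k + 3 * real n + 5/2) * (real k + 3 * real n + 7/2)" .
  define u v w y z where uvwyz: "u = real k + 3 * real n + 3/2" "v = real k + 3 * real n + 5/2"
    "w = real k + 3 * real n + 7/2" "y = real k + 2 * real n + 1" "z = real k + 2 * real n + 3"
  have pos: "u > 0" "v > 0" "w > 0" "y > 0" "z > 0"
    by (simp_all add: uvwyz)
  have z: "real k + 2 * real (Suc n) + 1 = z" by (simp add: uvwyz)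
  define a b where ab: "a = pochhammer (1/2 :: real) n" "b = pochhammer (3/2 :: real) n"
  have "wz_kernel (Suc n) k = (-1) ^ Suc n * (a * (real n + 1/2)) * (b * (real n + 3/2))
      / (2 * (p * u / x * v * w) * z)"
    unfolding wz_kernel_def * z by (simp add: pochhammer_Suc ab uvwyz algebra_simps)
  also have "\<dots> = - ((-1) ^ n * a * b / (2 * p * y)) *
      ((real n + 1/2) * (real n + 3/2) * x * y / (u * v * w * z))"
    using pos x p by (simp add: field_simps)
  finally show ?thesis
    by (simp add: wz_kernel_def ab p_def x_def uvwyz)
qed

text \<open>This is the Wilf--Zeilberger equation divided by \<open>wz_kernel n k\<close>, with
  \<open>x\<close> for \<open>n\<close> and \<open>y\<close> for \<open>k\<close>. The sign
  assumptions keep all denominators positive.\<close>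

lemma wz_equation_rational:
  fixes x y :: real
  assumes "x \<ge> 0" "y \<ge> 0"
  shows "(y + x + 1/2) * (y + 2 * x + 1) / ((y + 3 * x + 3/2) * (y + 2 * x + 2)) * wz_cert x (y + 1)
      - wz_cert x y
    = - ((x + 1/2) * (x + 3/2) * (y + x + 1/2) * (y + 2 * x + 1)
        / ((y + 3 * x + 3/2) * (y + 3 * x + 5/2) * (y + 3 * x + 7/2) * (y + 2 * x + 3))) - 1"
proof -
  define a b c d e f g h where ab: "a = y + 3 * x + 3/2" "b = y + 3 * x + 5/2" "c = y + 3 * x + 7/2"
    "d = y + 2 * x + 2" "e = y + 2 * x + 3" "f = 8 * (x + 1) * (2 * x + 1)" "g = y + x + 1/2"
    "h = y + 2 * x + 1"
  have pos: "a > 0" "b > 0" "c > 0" "d > 0" "e > 0" "f > 0"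
    using assms by (auto simp: ab intro!: mult_pos_pos)
  have c: "wz_cert x (y + 1) = wz_num x (y + 1) / (f * e * b * c)"
    "wz_cert x y = wz_num x y / (f * d * a * b)"
    by (simp_all add: wz_cert_def ab algebra_simps)
  \<comment> \<open>The equation over the common denominator \<open>a * b * c * d * e * f\<close>;
    the factor \<open>f * d\<close> on the right then cancels.\<close>
  have key: "g * h * wz_num x (y + 1) - wz_num x y * c * e
      = - f * d * ((x + 1/2) * (x + 3/2) * g * h + a * b * c * e)"
    unfolding wz_num_def ab by algebra
  have "g * h / (a * d) * (wz_num x (y + 1) / (f * e * b * c)) - wz_num x y / (f * d * a * b)
      = (g * h * wz_num x (y + 1) - wz_num x y * c * e) / (a * b * c * d * e * f)"
    using pos by (simp add: divide_simps)
  also have "\<dots> = - ((x + 1/2) * (x + 3/2) * g * h / (a * b * c * e)) - 1"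
    unfolding key using pos by (simp add: divide_simps)
  finally show ?thesis by (simp only: c ab[symmetric])
qed

lemma wz_equation:
  "wz_kernel n (Suc k) * wz_cert (real n) (real (Suc k)) - wz_kernel n k * wz_cert (real n) (real k)
    = wz_kernel (Suc n) k - wz_kernel n k"
proof -
  have "wz_kernel n (Suc k) * wz_cert (real n) (real (Suc k))
      - wz_kernel n k * wz_cert (real n) (real k)
      = wz_kernel n k * ((real k + real n + 1/2) * (real k + 2 * real n + 1)
      / ((real k + 3 * real n + 3/2) * (real k + 2 * real n + 2)) * wz_cert (real n) (real k + 1)
      - wz_cert (real n) (real k))"
    unfolding wz_kernel_Suc_right by (simp add: algebra_simps)
  also have "\<dots> = wz_kernel (Suc n) k - wz_kernel n k"
    unfolding wz_kernel_Suc_left by (subst wz_equation_rational) (simp_all add: right_diff_distrib)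
  finally show ?thesis .
qed

section \<open>Row sums of the kernel\<close>

lemma wz_kernel_0: "wz_kernel 0 k = 1 / ((2 * real k + 1) * (real k + 1))"
  by (simp add: wz_kernel_def divide_simps)

text \<open>By partial fractions, row 0 is twice the alternating harmonic series with its terms
  taken in pairs.\<close>

lemma wz_kernel_0_sums: "wz_kernel 0 sums (2 * ln 2)"
proof -
  have "(\<lambda>k. 2 * (inverse (real (2 * k + 1)) - inverse (real (2 * k + 2)))) sums (2 * ln 2)"
    by (intro sums_mult alternating_harmonic_series_sums')
  moreover have "2 * (inverse (real (2 * k + 1)) - inverse (real (2 * k + 2))) = wz_kernel 0 k" for k
    unfolding wz_kernel_0 by (simp add: divide_simps) (simp add: algebra_simps)
  ultimately show ?thesis by simp
qed

text \<open>The bound is uniform in \<open>k\<close>, so it yields both the summability of each row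
  and the decay of the row sums.\<close>

lemma abs_wz_kernel_le: "\<bar>wz_kernel n k\<bar> \<le> (1/3) ^ n * wz_kernel 0 k"
proof (induction n)
  case 0
  show ?case by (simp add: wz_kernel_0)
next
  case (Suc n)
  \<comment> \<open>The factors of the shift quotient are paired so that each fraction is at most 1
    and the first at most 1/3.\<close>
  define r where "r = (real n + 1/2) / (real k + 3 * real n + 7/2)
      * ((real n + 3/2) / (real k + 3 * real n + 5/2))
      * ((real k + real n + 1/2) / (real k + 3 * real n + 3/2))
      * ((real k + 2 * real n + 1) / (real k + 2 * real n + 3))"
  have "r \<ge> 0" by (simp add: r_def)
  have "r \<le> 1/3 * 1 * 1 * 1"
    unfolding r_def by (intro mult_mono) (auto simp: divide_simps)
  have "wz_kernel (Suc n) k = - wz_kernel n k * r"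
    unfolding wz_kernel_Suc_left r_def by (simp add: mult_ac)
  hence "\<bar>wz_kernel (Suc n) k\<bar> = \<bar>wz_kernel n k\<bar> * r"
    using \<open>r \<ge> 0\<close> by (simp add: abs_mult)
  also have "\<dots> \<le> ((1/3) ^ n * wz_kernel 0 k) * (1/3)"
    using \<open>r \<ge> 0\<close> \<open>r \<le> _\<close> Suc.IH by (intro mult_mono) auto
  finally show ?case by simp
qed

lemma wz_kernel_summable: "summable (wz_kernel n)"
proof (rule summable_comparison_test')
  show "summable (\<lambda>k. (1/3) ^ n * wz_kernel 0 k)"
    using wz_kernel_0_sums by (intro summable_mult) (auto simp: sums_iff)
  show "norm (wz_kernel n k) \<le> (1/3) ^ n * wz_kernel 0 k" for k
    using abs_wz_kernel_le by simp
qed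

lemma wz_row_sum_tendsto_0: "(\<lambda>n. \<Sum>k. wz_kernel n k) \<longlonglongrightarrow> 0"
proof (rule Lim_null_comparison)
  have "norm (\<Sum>k. wz_kernel n k) \<le> (1/3) ^ n * (2 * ln 2)" for n
  proof -
    have s: "(\<lambda>k. (1/3) ^ n * wz_kernel 0 k) sums ((1/3) ^ n * (2 * ln 2))"
      by (intro sums_mult wz_kernel_0_sums)
    have "norm (\<Sum>k. wz_kernel n k) \<le> (\<Sum>k. (1/3) ^ n * wz_kernel 0 k)"
      using s abs_wz_kernel_le by (intro norm_suminf_le) (auto simp: sums_iff)
    with s show ?thesis by (simp add: sums_iff)
  qed
  thus "\<forall>\<^sub>F n in sequentially. norm (\<Sum>k. wz_kernel n k) \<le> (1/3) ^ n * (2 * ln 2)"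
    by simp
  show "(\<lambda>n. (1/3) ^ n * (2 * ln 2 :: real)) \<longlonglongrightarrow> 0"
    by (intro tendsto_mult_left_zero LIMSEQ_power_zero) auto
qed

section \<open>Decay of the mate along a row\<close>

lemma wz_num_nonneg: "x \<ge> 0 \<Longrightarrow> y \<ge> 0 \<Longrightarrow> wz_num x y \<ge> 0"
  unfolding wz_num_def by (intro add_nonneg_nonneg mult_nonneg_nonneg; simp)

text \<open>The coefficients of the powers of \<open>y\<close> are nonnegative with sum
  \<open>wz_num x 1\<close>, and each power involved is at most \<open>(y + 1) ^ 4\<close>.\<close>

lemma wz_num_le:
  assumes "x \<ge> 0" "y \<ge> 0"
  shows "wz_num x y \<le> wz_num x 1 * (y + 1) ^ 4"
proof -
  define c0 c1 c2 c3 c4 where c: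
    "c0 = 84 + 612 * x + 1744 * x^2 + 2432 * x^3 + 1664 * x^4 + 448 * x^5"
    "c1 = 185 + 1052 * x + 2196 * x^2 + 2000 * x^3 + 672 * x^4"
    "c2 = 157 + 636 * x + 844 * x^2 + 368 * x^3"
    "c3 = 58 + 144 * x + 88 * x^2" "c4 = 8 + 8 * x"
  have num: "wz_num x z = c0 * z^0 + c1 * z^1 + c2 * z^2 + c3 * z^3 + c4 * z^4" for z
    by (simp add: wz_num_def c)
  have nonneg: "c0 \<ge> 0" "c1 \<ge> 0" "c2 \<ge> 0" "c3 \<ge> 0" "c4 \<ge> 0"
    using assms by (simp_all add: c)
  have pow: "y ^ m \<le> (y + 1) ^ 4" if "m \<le> 4" for m
  proof -
    have "y ^ m \<le> (y + 1) ^ m" using assms by (intro power_mono) auto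
    also have "\<dots> \<le> (y + 1) ^ 4" using assms that by (intro power_increasing) auto
    finally show ?thesis .
  qed
  have "wz_num x y \<le> c0 * (y + 1)^4 + c1 * (y + 1)^4 + c2 * (y + 1)^4 + c3 * (y + 1)^4
      + c4 * (y + 1)^4"
    unfolding num by (intro add_mono mult_left_mono pow nonneg) auto
  also have "\<dots> = wz_num x 1 * (y + 1)^4"
    unfolding num by (simp add: distrib_right)
  finally show ?thesis .
qed

text \<open>For fixed \<open>n\<close> the certificate has degree 4 over degree 3 in
  \<open>k\<close>, so it grows at most linearly, while the kernel is of order
  \<open>1 / k^2\<close>.\<close>

lemma wz_mate_tendsto_0: "(\<lambda>k. wz_kernel n k * wz_cert (real n) (real k)) \<longlonglongrightarrow> 0"
proof (rule Lim_null_comparison)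
  define x where "x = real n"
  define A where "A = wz_num x 1"
  have x: "x \<ge> 0" by (simp add: x_def)
  have "norm (wz_kernel n k * wz_cert (real n) (real k)) \<le> A / real (Suc k)" for k
  proof -
    define y where "y = real k"
    have y: "y \<ge> 0" by (simp add: y_def)
    have cert: "0 \<le> wz_cert x y" "wz_cert x y \<le> A * (y + 1) ^ 4 / (y + 1) ^ 3"
    proof -
      have "A \<ge> 0" unfolding A_def using x by (intro wz_num_nonneg) auto
      show "0 \<le> wz_cert x y" unfolding wz_cert_def using x y wz_num_nonneg[of x y] by simp
      \<comment> \<open>The factors in \<open>x\<close> alone contribute at least 1, the other three
        at least \<open>y + 1\<close> each.\<close>
      have "1 * 1 * (y + 1) * (y + 1) * (y + 1) \<le>
        8 * (x + 1) * (2 * x + 1) * (y + 2 * x + 2) * (y + 3 * x + 3/2) * (y + 3 * x + 5/2)"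
        using x y by (intro mult_mono mult_nonneg_nonneg) auto
      thus "wz_cert x y \<le> A * (y + 1) ^ 4 / (y + 1) ^ 3"
        unfolding wz_cert_def using wz_num_le[OF x y, folded A_def] x y \<open>A \<ge> 0\<close>
        by (intro frac_le) (auto simp: power3_eq_cube)
    qed
    have "norm (wz_kernel n k) \<le> (1/3) ^ n * wz_kernel 0 k"
      using abs_wz_kernel_le by simp
    also have "\<dots> \<le> wz_kernel 0 k"
      by (intro mult_left_le_one_le power_le_one) (auto simp: wz_kernel_0)
    also have "\<dots> \<le> 1 / (y + 1)\<^sup>2"
      unfolding wz_kernel_0 y_def[symmetric] power2_eq_square using y
      by (intro frac_le mult_mono) auto
    finally have "norm (wz_kernel n k * wz_cert x y) \<le> 1 / (y + 1)\<^sup>2 * (A * (y + 1) ^ 4 / (y + 1) ^ 3)"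
      unfolding norm_mult using cert by (intro mult_mono) auto
    also have "\<dots> = A / (y + 1)"
      using y by (simp add: divide_simps power2_eq_square power3_eq_cube power4_eq_xxxx)
    finally show ?thesis by (simp add: x_def y_def add.commute)
  qed
  thus "\<forall>\<^sub>F k in sequentially. norm (wz_kernel n k * wz_cert (real n) (real k)) \<le> A / real (Suc k)"
    by simp
  show "(\<lambda>k. A / real (Suc k)) \<longlonglongrightarrow> 0"
    using tendsto_mult_right_zero[OF LIMSEQ_inverse_real_of_nat, of A] by (simp add: divide_inverse)
qed

section \<open>Telescoping along rows and across rows\<close>

lemma wz_row_sum_diff:
  "(\<Sum>k. wz_kernel n k) - (\<Sum>k. wz_kernel (Suc n) k) = wz_kernel n 0 * wz_cert (real n) 0"
proof -
  \<comment> \<open>The 0 is the limit of the mate, so only its value at \<open>k = 0\<close>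
    survives.\<close>
  have "(\<lambda>k. wz_kernel (Suc n) k - wz_kernel n k) sums (0 - wz_kernel n 0 * wz_cert (real n) (real 0))"
    using telescope_sums[OF wz_mate_tendsto_0[of n]] unfolding wz_equation .
  moreover have "(\<lambda>k. wz_kernel (Suc n) k - wz_kernel n k) sums
      ((\<Sum>k. wz_kernel (Suc n) k) - (\<Sum>k. wz_kernel n k))"
    by (intro sums_diff summable_sums wz_kernel_summable)
  ultimately show ?thesis
    using sums_unique2 by fastforce
qed

lemma wz_boundary_sums: "(\<lambda>n. wz_kernel n 0 * wz_cert (real n) 0) sums (2 * ln 2)"
proof -
  \<comment> \<open>Now the telescoping is in \<open>n\<close>, and the 0 is the limit of the row
    sums.\<close>
  have "(\<lambda>n. (\<Sum>k. wz_kernel n k) - (\<Sum>k. wz_kernel (Suc n) k)) sums ((\<Sum>k. wz_kernel 0 k) - 0)"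
    by (intro telescope_sums' wz_row_sum_tendsto_0)
  thus ?thesis
    using wz_kernel_0_sums by (simp add: wz_row_sum_diff sums_iff)
qed

section \<open>Identification of the boundary terms\<close>

lemma fact_double_div: "fact (2 * k) / fact k = (4 ^ k * pochhammer (1/2) k :: real)"
  using fact_double[of k, where ?'a = real] by (simp add: power_mult)

lemma binomial_quotient_conv_pochhammer:
  "(real ((2 * k) choose k))\<^sup>2 / (real ((6 * k) choose (3 * k)) * real ((3 * k) choose k))
    = pochhammer (1/2) k ^ 3 / pochhammer (1/2) (3 * k)"
proof -
  have "(real ((2 * k) choose k))\<^sup>2 / (real ((6 * k) choose (3 * k)) * real ((3 * k) choose k))
    = (fact (2 * k) / fact k) ^ 3 / (fact (2 * (3 * k)) / fact (3 * k))"
    by (simp add: binomial_fact field_simps power2_eq_square power3_eq_cube)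
  \<comment> \<open>Numerator and denominator both carry the power \<open>4 ^ (3 * k)\<close>, which
    cancels.\<close>
  also have "\<dots> = pochhammer (1/2) k ^ 3 / pochhammer (1/2) (3 * k)"
    unfolding fact_double_div by (simp add: power_mult_distrib flip: power_mult) (simp add: mult.commute)
  finally show ?thesis .
qed

text \<open>Passing from \<open>n\<close> to \<open>Suc n\<close> in the cube adds three factors
  \<open>n + 1/2\<close>. Up to a constant, the squared odd number in the denominator removes two of
  them, and the certificate supplies the third.\<close>

lemma wz_boundary_eq_term:
  "wz_kernel n 0 * wz_cert (real n) 0 =
     (-1) ^ n * (28 * (real (Suc n))\<^sup>2 - 8 * real (Suc n) + 1)
     / ((2 * real (Suc n) - 1)\<^sup>2 * real (Suc n))
     * (pochhammer (1/2) (Suc n) ^ 3 / pochhammer (1/2) (3 * Suc n))"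
proof -
  define x where "x = real n"
  define p q where pq: "p = pochhammer (1/2 :: real) n" "q = pochhammer (1/2 :: real) (3 * n + 1)"
  have pos: "p > 0" "q > 0" "x \<ge> 0"
    by (simp_all add: pq x_def pochhammer_pos del: pochhammer_Suc)
  have "pochhammer (3/2 :: real) n = p * (x + 1/2) * 2"
    using pochhammer_shift[of "1/2 :: real" n] by (simp add: pq x_def)
  \<comment> \<open>The symbol \<open>q\<close> splits after its first \<open>n\<close>
    factors.\<close>
  moreover have "pochhammer (x + 1/2) (2 * n + 1) = q / p"
    using pochhammer_product'[of "1/2 :: real" n "2 * n + 1"] pos
    by (simp add: pq x_def add.commute)
  ultimately have "wz_kernel n 0 = (-1) ^ n * p * (p * (x + 1/2) * 2) / (2 * (q / p) * (2 * x + 1))"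
    by (simp add: wz_kernel_def x_def pq)
  also have "\<dots> = (-1) ^ n * p ^ 3 / (2 * q)"
    using pos by (simp add: divide_simps power3_eq_cube)
  finally have V: "wz_kernel n 0 = (-1) ^ n * p ^ 3 / (2 * q)" .
  \<comment> \<open>At \<open>y = 0\<close> the numerator has the factor
    \<open>8 * (x + 1) * (2 * x + 1)\<close>, which cancels; the remaining quadratic is that of the
    series, expanded at \<open>k = x + 1\<close>.\<close>
  have C: "wz_cert x 0 = (28 * x^2 + 48 * x + 21) * (x + 1/2)
      / ((2 * x + 2) * (3 * x + 3/2) * (3 * x + 5/2))"
  proof -
    have "84 + 612 * x + 1744 * x^2 + 2432 * x^3 + 1664 * x^4 + 448 * x^5
        = (28 * x^2 + 48 * x + 21) * (x + 1/2) * (8 * (x + 1) * (2 * x + 1))"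
      by algebra
    thus ?thesis using pos by (simp add: wz_cert_def wz_num_def)
  qed
  have P: "pochhammer (1/2 :: real) (Suc n) = p * (x + 1/2)"
    by (simp add: pochhammer_Suc pq x_def add.commute)
  \<comment> \<open>The two factors beyond \<open>q\<close> are those in the denominator of
    \<open>wz_cert x 0\<close>.\<close>
  have "3 * Suc n = Suc (Suc (3 * n + 1))" by simp
  hence Q: "pochhammer (1/2 :: real) (3 * Suc n) = q * (3 * x + 3/2) * (3 * x + 5/2)"
    by (simp only: pochhammer_Suc pq) (simp add: x_def algebra_simps)
  define u v where uv: "u = 3 * x + 3/2" "v = 3 * x + 5/2"
  have uvpos: "u > 0" "v > 0" using pos by (simp_all add: uv)
  define y where "y = x + 1/2"
  have y: "y > 0" using pos by (simp add: y_def)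
  have S: "real (Suc n) = x + 1" "28 * (x + 1)\<^sup>2 - 8 * (x + 1) + 1 = 28 * x^2 + 48 * x + 21"
    "2 * (x + 1) - 1 = 2 * y"
    by (simp_all add: x_def y_def power2_eq_square algebra_simps)
  have x1: "x + 1 > 0" "2 * x + 2 = 2 * (x + 1)" using pos by simp_all
  show ?thesis
    unfolding V x_def[symmetric] C P Q S uv[symmetric] y_def[symmetric] x1(2)
    using pos uvpos y x1(1)
    by (simp add: divide_simps power2_eq_square power3_eq_cube)
qed

theorem theorem1p1:
  shows "(\<lambda>n. let k = Suc n in
            ((-1) ^ (k - 1) * (28 * (real k)\<^sup>2 - 8 * real k + 1) * (real ((2 * k) choose k))\<^sup>2)
            / ((2 * real k - 1)\<^sup>2 * real k
                * real ((6 * k) choose (3 * k)) * real ((3 * k) choose k)))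
         sums (2 * ln (2 :: real))"
proof -
  have "(let k = Suc n in
            ((-1) ^ (k - 1) * (28 * (real k)\<^sup>2 - 8 * real k + 1) * (real ((2 * k) choose k))\<^sup>2)
            / ((2 * real k - 1)\<^sup>2 * real k
                * real ((6 * k) choose (3 * k)) * real ((3 * k) choose k)))
        = wz_kernel n 0 * wz_cert (real n) 0" for n
    unfolding Let_def wz_boundary_eq_term binomial_quotient_conv_pochhammer[symmetric]
    by (simp only: times_divide_times_eq diff_Suc_1 mult.assoc)
  thus ?thesis using wz_boundary_sums by simp
qed

end
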